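(* Let $A$ be a unital associative algebra over a field $k$, contained as a subspace of codimension $1$ in a $k$-vector space $E$. Then: (1) $\mathrm{Extd}(E,A)\cong\mathcal{AH}^2_A(k,A)\cong\mathcal{F}(A)/\equiv$, where $\equiv$ is the equivalence relation on the set $\mathcal{F}(A)$ of flag datums of $A$ defined as follows: $(\Lambda,\lambda,D,d,a_0,u)\equiv(\Lambda',\lambda',D',d',a_0',u')$ if and only if $\Lambda=\Lambda'$, $\lambda=\lambda'$ and there exists a pair $(q,\alpha)\in k^*\times A$ such that for all $a\in A$: $$D(a)=q\,D'(a)+\alpha\,a-\Lambda(a)\,\alpha,\qquad d(a)=q\,d'(a)+a\,\alpha-\lambda(a)\,\alpha,$$ $$a_0=q^2a_0'+\alpha^2-u\,\alpha+q\,d'(\alpha)+q\,D'(\alpha),\qquad u=q\,u'+\lambda'(\alpha)+\Lambda'(\alpha).$$ The bijection between $\mathcal{F}(A)/\equiv$ and $\mathrm{Extd}(E,A)$ is given by $\overline{(\Lambda,\lambda,D,d,a_0,u)}\mapsto A\ltimes_{(\Lambda,\lambda,D,d,a_0,u)}x$. (2) $\mathrm{Extd}'(E,A)\cong\mathcal{AH}^2(k,A)\cong\mathcal{F}(A)/\approx$, where $\approx$ is the relation on $\mathcal{F}(A)$ defined by: $(\Lambda,\lambda,D,d,a_0,u)\approx(\Lambda',\lambda',D',d',a_0',u')$ if and only if $\Lambda=\Lambda'$, $\lambda=\lambda'$ and there exists $\alpha\in A$ such that the four displayed equations of (1) hold with $q=1$. The bijection between $\mathcal{F}(A)/\approx$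 and $\mathrm{Extd}'(E,A)$ is given by $\overline{\overline{(\Lambda,\lambda,D,d,a_0,u)}}\mapsto A\ltimes_{(\Lambda,\lambda,D,d,a_0,u)}x$. Overlines denote the classes with respect to $\equiv$ and (double) $\approx$.
   Context: All vector spaces, linear and bilinear maps are over an arbitrary field $k$. "Algebra" means unital associative $k$-algebra; subalgebras contain the unit and algebra maps preserve units. Classifying sets. Fix a complement $V$ of $A$ in $E$ and let $\pi:E=A\oplus V\to V$ be the canonical projection; here $\dim V=1$, $\{x\}$ is a basis of $V$ and $V\cong k$. A linear map $\varphi:E\to E$ stabilizes $A$ if $\varphi(a)=a$ for all $a\in A$, and co-stabilizes $V$ if $\pi\circ\varphi=\pi$. $\mathrm{Extd}(E,A)$ (resp. $\mathrm{Extd}'(E,A)$) is the set of classes of algebra structures on $E$ containing $A$ as a subalgebra, two structures being identified when there is an algebra isomorphism between them stabilizing $A$ (resp. stabilizing $A$ and co-stabilizing $V$). Flag datums. A flag datum of $A$ is a $6$-tuple $(\Lambda,\lambda,D,d,a_0,u)$ with $\Lambda,\lambda:A\to k$ algebra maps, $D,d:A\to A$ linear maps, $a_0\in A$, $u\in k$, such that for all $a,b\in A$: $\Lambda(a_0)=\lambda(a_0)$, $D(a_0)=d(a_0)$, $\lambda\circ d=0$, $\Lambda\circ D=0$; $d(ab)=a\,d(b)+d(a)\lambda(b)$, $D(ab)=\Lambda(a)D(b)+D(a)b$; $d^2(a)=u\,d(a)+a\,a_0-\lambda(a)a_0$, $D^2(a)=u\,D(a)+a_0\,a-\Lambda(a)a_0$;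 $D(d(a))-d(D(a))=(\Lambda(a)-\lambda(a))a_0$; $\Lambda(d(a))-\lambda(D(a))=(\Lambda(a)-\lambda(a))u$; $a\,D(b)+\Lambda(b)d(a)=d(a)\,b+\lambda(a)D(b)$. $\mathcal{F}(A)$ is the set of all flag datums of $A$. For a flag datum, $A\ltimes_{(\Lambda,\lambda,D,d,a_0,u)}x$ is the algebra on $A\oplus kx\cong E$ extending the multiplication of $A$ with $x^2=a_0+u\,x$, $ax=d(a)+\lambda(a)x$, $xa=D(a)+\Lambda(a)x$ for all $a\in A$. Cohomological objects. An algebra extending structure of $A$ through $V$ is a system $(\triangleleft,\triangleright,\leftharpoonup,\rightharpoonup,f,\cdot)$ of bilinear maps $\triangleleft:V\times A\to V$, $\triangleright:V\times A\to A$, $\leftharpoonup:A\times V\to A$, $\rightharpoonup:A\times V\to V$, $f:V\times V\to A$, $\cdot:V\times V\to V$ such that $(a,x)\bullet(b,y)=(ab+a\leftharpoonup y+x\triangleright b+f(x,y),\ a\rightharpoonup y+x\triangleleft b+x\cdot y)$ is associative on $A\times V$ with unit $(1_A,0)$; $\mathcal{AE}(A,V)$ is the set of these. $\mathcal{AH}^2_A(V,A)$ is the quotient of $\mathcal{AE}(A,V)$ by the equivalence relation: $(\triangleleft,\ldots,\cdot)\equiv(\triangleleft',\ldots,\cdot')$ iff there exist a linear map $r:V\to A$ and a linear automorphism $v$ of $V$ such that, with $w=v^{-1}$, for all $a\in A$, $x,y\in V$: $a\rightharpoonup' x=v(a\rightharpoonup w(x))$; $a\leftharpoonup' x=r(a\rightharpoonup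 w(x))-a\,r(w(x))+a\leftharpoonup w(x)$; $x\triangleleft' a=v(w(x)\triangleleft a)$; $x\triangleright' a=r(w(x)\triangleleft a)-r(w(x))a+w(x)\triangleright a$; $x\cdot' y=v(w(x)\cdot w(y))-v(r(w(x))\rightharpoonup w(y))-v(w(x)\triangleleft r(w(y)))$; $f'(x,y)=r(w(x)\cdot w(y))+f(w(x),w(y))-r(r(w(x))\rightharpoonup w(y))-r(w(x))\leftharpoonup w(y)-r(w(x)\triangleleft r(w(y)))+r(w(x))r(w(y))-w(x)\triangleright r(w(y))$. $\mathcal{AH}^2(V,A)$ is the quotient of $\mathcal{AE}(A,V)$ by the equivalence relation given by the same formulas with $v=\mathrm{Id}_V$. $\mathcal{AH}^2_A(k,A)$ and $\mathcal{AH}^2(k,A)$ are these for $V=k$. *)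

theory Defs
  imports Complex_Main
begin

section \<open>Algebras over a field\<close>

text \<open>
  A vector space over a field \<open>'k\<close> is given by its scalar multiplication, as in
  \<^theory>\<open>HOL.Vector_Spaces\<close>; the field itself is the vector space with scalar
  multiplication \<open>(*)\<close>.  Note that \<^const>\<open>Vector_Spaces.linear\<close> includes that
  source and target are vector spaces.
\<close>

definition bilinear_map ::
  "('k::field \<Rightarrow> 'a::ab_group_add \<Rightarrow> 'a) \<Rightarrow> ('k \<Rightarrow> 'b::ab_group_add \<Rightarrow> 'b) \<Rightarrow>
   ('k \<Rightarrow> 'c::ab_group_add \<Rightarrow> 'c) \<Rightarrow> ('a \<Rightarrow> 'b \<Rightarrow> 'c) \<Rightarrow> bool" where
  "bilinear_map s1 s2 s3 h \<longleftrightarrow>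
     (\<forall>x. Vector_Spaces.linear s2 s3 (\<lambda>y. h x y)) \<and>
     (\<forall>y. Vector_Spaces.linear s1 s3 (\<lambda>x. h x y))"

definition assoc_with_unit :: "('a \<Rightarrow> 'a \<Rightarrow> 'a) \<Rightarrow> 'a \<Rightarrow> bool" where
  "assoc_with_unit m e \<longleftrightarrow>
     (\<forall>x y z. m (m x y) z = m x (m y z)) \<and> (\<forall>x. m e x = x \<and> m x e = x)"

definition unital_algebra ::
  "('k::field \<Rightarrow> 'a::ab_group_add \<Rightarrow> 'a) \<Rightarrow> ('a \<Rightarrow> 'a \<Rightarrow> 'a) \<Rightarrow> 'a \<Rightarrow> bool" where
  "unital_algebra s m e \<longleftrightarrow> vector_space s \<and> bilinear_map s s s m \<and> assoc_with_unit m e"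

definition algebra_map ::
  "('k::field \<Rightarrow> 'a::ab_group_add \<Rightarrow> 'a) \<Rightarrow> ('a \<Rightarrow> 'a \<Rightarrow> 'a) \<Rightarrow> 'a \<Rightarrow>
   ('k \<Rightarrow> 'b::ab_group_add \<Rightarrow> 'b) \<Rightarrow> ('b \<Rightarrow> 'b \<Rightarrow> 'b) \<Rightarrow> 'b \<Rightarrow> ('a \<Rightarrow> 'b) \<Rightarrow> bool" where
  "algebra_map s m e s' m' e' h \<longleftrightarrow>
     Vector_Spaces.linear s s' h \<and> (\<forall>x y. h (m x y) = m' (h x) (h y)) \<and> h e = e'"


section \<open>The extension problem\<close>

text \<open>
  The algebra \<open>A\<close> is a type of class \<open>{ring, monoid_mult}\<close> (a ring with unit, where, in
  contrast to \<open>ring_1\<close>, \<open>0 = 1\<close> is not excluded) with a scalar multiplication \<open>sA\<close>, and the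
  inclusion of \<open>A\<close> into the vector space \<open>E\<close> is an injective linear map \<open>\<iota>\<close>.
\<close>

definition proj_along :: "'e::ab_group_add set \<Rightarrow> 'e set \<Rightarrow> 'e \<Rightarrow> 'e" where
  "proj_along U V e = (THE v. v \<in> V \<and> e - v \<in> U)"

definition stabilizes :: "('a \<Rightarrow> 'e) \<Rightarrow> ('e \<Rightarrow> 'e) \<Rightarrow> bool" where
  "stabilizes \<iota> \<phi> \<longleftrightarrow> (\<forall>a. \<phi> (\<iota> a) = \<iota> a)"

definition costabilizes :: "('a \<Rightarrow> 'e::ab_group_add) \<Rightarrow> 'e set \<Rightarrow> ('e \<Rightarrow> 'e) \<Rightarrow> bool" where
  "costabilizes \<iota> V \<phi> \<longleftrightarrow>
     proj_along (range \<iota>) V \<circ> \<phi> = proj_along (range \<iota>) V"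

text \<open>
  Algebra structures on \<open>E\<close> with \<open>A\<close> as a subalgebra.  A structure is represented by its
  multiplication; since subalgebras contain the unit, the unit of \<open>E\<close> is \<open>\<iota> 1\<close>.
\<close>

definition alg_structs ::
  "('k::field \<Rightarrow> 'a::{ring,monoid_mult} \<Rightarrow> 'a) \<Rightarrow> ('k \<Rightarrow> 'e::ab_group_add \<Rightarrow> 'e) \<Rightarrow>
   ('a \<Rightarrow> 'e) \<Rightarrow> ('e \<Rightarrow> 'e \<Rightarrow> 'e) set" where
  "alg_structs sA sE \<iota> =
     {m. unital_algebra sE m (\<iota> 1) \<and> algebra_map sA (*) 1 sE m (\<iota> 1) \<iota>}"

definition alg_iso ::
  "('k::field \<Rightarrow> 'e::ab_group_add \<Rightarrow> 'e) \<Rightarrow> 'e \<Rightarrow>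
   ('e \<Rightarrow> 'e \<Rightarrow> 'e) \<Rightarrow> ('e \<Rightarrow> 'e \<Rightarrow> 'e) \<Rightarrow> ('e \<Rightarrow> 'e) \<Rightarrow> bool" where
  "alg_iso sE e m m' \<phi> \<longleftrightarrow> algebra_map sE m e sE m' e \<phi> \<and> bij \<phi>"

definition extd_rel ::
  "('k::field \<Rightarrow> 'a::{ring,monoid_mult} \<Rightarrow> 'a) \<Rightarrow> ('k \<Rightarrow> 'e::ab_group_add \<Rightarrow> 'e) \<Rightarrow>
   ('a \<Rightarrow> 'e) \<Rightarrow> (('e \<Rightarrow> 'e \<Rightarrow> 'e) \<times> ('e \<Rightarrow> 'e \<Rightarrow> 'e)) set" where
  "extd_rel sA sE \<iota> =
     {(m, m'). m \<in> alg_structs sA sE \<iota> \<and> m' \<in> alg_structs sA sE \<iota> \<and>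
        (\<exists>\<phi>. alg_iso sE (\<iota> 1) m m' \<phi> \<and> stabilizes \<iota> \<phi>)}"

definition extd'_rel ::
  "('k::field \<Rightarrow> 'a::{ring,monoid_mult} \<Rightarrow> 'a) \<Rightarrow> ('k \<Rightarrow> 'e::ab_group_add \<Rightarrow> 'e) \<Rightarrow>
   ('a \<Rightarrow> 'e) \<Rightarrow> 'e set \<Rightarrow> (('e \<Rightarrow> 'e \<Rightarrow> 'e) \<times> ('e \<Rightarrow> 'e \<Rightarrow> 'e)) set" where
  "extd'_rel sA sE \<iota> V =
     {(m, m'). m \<in> alg_structs sA sE \<iota> \<and> m' \<in> alg_structs sA sE \<iota> \<and>
        (\<exists>\<phi>. alg_iso sE (\<iota> 1) m m' \<phi> \<and> stabilizes \<iota> \<phi> \<and> costabilizes \<iota> V \<phi>)}"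

definition Extd ::
  "('k::field \<Rightarrow> 'a::{ring,monoid_mult} \<Rightarrow> 'a) \<Rightarrow> ('k \<Rightarrow> 'e::ab_group_add \<Rightarrow> 'e) \<Rightarrow>
   ('a \<Rightarrow> 'e) \<Rightarrow> ('e \<Rightarrow> 'e \<Rightarrow> 'e) set set" where
  "Extd sA sE \<iota> = alg_structs sA sE \<iota> // extd_rel sA sE \<iota>"

definition Extd' ::
  "('k::field \<Rightarrow> 'a::{ring,monoid_mult} \<Rightarrow> 'a) \<Rightarrow> ('k \<Rightarrow> 'e::ab_group_add \<Rightarrow> 'e) \<Rightarrow>
   ('a \<Rightarrow> 'e) \<Rightarrow> 'e set \<Rightarrow> ('e \<Rightarrow> 'e \<Rightarrow> 'e) set set" where
  "Extd' sA sE \<iota> V = alg_structs sA sE \<iota> // extd'_rel sA sE \<iota> V"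


section \<open>Algebra extending structures and their cohomological quotients\<close>

text \<open>
  The components of a tuple \<open>(lt, rt, lh, rh, f, dt)\<close> stand for
  \<open>x \<triangleleft> a\<close>, \<open>x \<triangleright> a\<close>, \<open>a \<leftharpoonup> x\<close>, \<open>a \<rightharpoonup> x\<close>, \<open>f (x, y)\<close> and \<open>x \<cdot> y\<close>, in this order.
\<close>

type_synonym ('a, 'v) ext_system =
  "('v \<Rightarrow> 'a \<Rightarrow> 'v) \<times> ('v \<Rightarrow> 'a \<Rightarrow> 'a) \<times> ('a \<Rightarrow> 'v \<Rightarrow> 'a) \<times> ('a \<Rightarrow> 'v \<Rightarrow> 'v) \<times>
   ('v \<Rightarrow> 'v \<Rightarrow> 'a) \<times> ('v \<Rightarrow> 'v \<Rightarrow> 'v)"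

fun unified_mult ::
  "('a::{ring,monoid_mult}, 'v::ab_group_add) ext_system \<Rightarrow> 'a \<times> 'v \<Rightarrow> 'a \<times> 'v \<Rightarrow> 'a \<times> 'v" where
  "unified_mult (lt, rt, lh, rh, f, dt) (a, x) (b, y) =
     (a * b + lh a y + rt x b + f x y, rh a y + lt x b + dt x y)"

definition AE ::
  "('k::field \<Rightarrow> 'a::{ring,monoid_mult} \<Rightarrow> 'a) \<Rightarrow> ('k \<Rightarrow> 'v::ab_group_add \<Rightarrow> 'v) \<Rightarrow>
   ('a, 'v) ext_system set" where
  "AE sA sV = {(lt, rt, lh, rh, f, dt).
     bilinear_map sV sA sV lt \<and> bilinear_map sV sA sA rt \<and>
     bilinear_map sA sV sA lh \<and> bilinear_map sA sV sV rh \<and>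
     bilinear_map sV sV sA f \<and> bilinear_map sV sV sV dt \<and>
     assoc_with_unit (unified_mult (lt, rt, lh, rh, f, dt)) (1, 0)}"

fun ext_related ::
  "('v::ab_group_add \<Rightarrow> 'a::{ring,monoid_mult}) \<Rightarrow> ('v \<Rightarrow> 'v) \<Rightarrow>
   ('a, 'v) ext_system \<Rightarrow> ('a, 'v) ext_system \<Rightarrow> bool" where
  "ext_related r v (lt, rt, lh, rh, f, dt) (lt', rt', lh', rh', f', dt') \<longleftrightarrow>
     (let w = inv v in \<forall>a x y.
        rh' a x = v (rh a (w x)) \<and>
        lh' a x = r (rh a (w x)) - a * r (w x) + lh a (w x) \<and>
        lt' x a = v (lt (w x) a) \<and>
        rt' x a = r (lt (w x) a) - r (w x) * a + rt (w x) a \<and>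
        dt' x y = v (dt (w x) (w y)) - v (rh (r (w x)) (w y)) - v (lt (w x) (r (w y))) \<and>
        f' x y = r (dt (w x) (w y)) + f (w x) (w y) - r (rh (r (w x)) (w y))
                 - lh (r (w x)) (w y) - r (lt (w x) (r (w y)))
                 + r (w x) * r (w y) - rt (w x) (r (w y)))"

definition AH2A_rel ::
  "('k::field \<Rightarrow> 'a::{ring,monoid_mult} \<Rightarrow> 'a) \<Rightarrow> ('k \<Rightarrow> 'v::ab_group_add \<Rightarrow> 'v) \<Rightarrow>
   (('a, 'v) ext_system \<times> ('a, 'v) ext_system) set" where
  "AH2A_rel sA sV = {(S, S'). S \<in> AE sA sV \<and> S' \<in> AE sA sV \<and>
     (\<exists>r v. Vector_Spaces.linear sV sA r \<and> Vector_Spaces.linear sV sV v \<and> bij v \<and>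
            ext_related r v S S')}"

definition AH2_rel ::
  "('k::field \<Rightarrow> 'a::{ring,monoid_mult} \<Rightarrow> 'a) \<Rightarrow> ('k \<Rightarrow> 'v::ab_group_add \<Rightarrow> 'v) \<Rightarrow>
   (('a, 'v) ext_system \<times> ('a, 'v) ext_system) set" where
  "AH2_rel sA sV = {(S, S'). S \<in> AE sA sV \<and> S' \<in> AE sA sV \<and>
     (\<exists>r. Vector_Spaces.linear sV sA r \<and> ext_related r id S S')}"

definition AH2A ::
  "('k::field \<Rightarrow> 'a::{ring,monoid_mult} \<Rightarrow> 'a) \<Rightarrow> ('k \<Rightarrow> 'v::ab_group_add \<Rightarrow> 'v) \<Rightarrow>
   ('a, 'v) ext_system set set" where
  "AH2A sA sV = AE sA sV // AH2A_rel sA sV"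

definition AH2 ::
  "('k::field \<Rightarrow> 'a::{ring,monoid_mult} \<Rightarrow> 'a) \<Rightarrow> ('k \<Rightarrow> 'v::ab_group_add \<Rightarrow> 'v) \<Rightarrow>
   ('a, 'v) ext_system set set" where
  "AH2 sA sV = AE sA sV // AH2_rel sA sV"


section \<open>Flag datums\<close>

text \<open>
  In a tuple \<open>(L, l, D, d, a0, u)\<close> the components \<open>L\<close> and \<open>l\<close> are the two algebra maps
  usually written \<open>\<Lambda>\<close> and \<open>\<lambda>\<close>; \<open>D\<close> and \<open>L\<close> describe \<open>xa\<close>, \<open>d\<close> and \<open>l\<close> describe \<open>ax\<close>.
\<close>

type_synonym ('k, 'a) flag =
  "('a \<Rightarrow> 'k) \<times> ('a \<Rightarrow> 'k) \<times> ('a \<Rightarrow> 'a) \<times> ('a \<Rightarrow> 'a) \<times> 'a \<times> 'k"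

definition flag_datums ::
  "('k::field \<Rightarrow> 'a::{ring,monoid_mult} \<Rightarrow> 'a) \<Rightarrow> ('k, 'a) flag set" where
  "flag_datums sA = {(L, l, D, d, a0, u).
     algebra_map sA (*) 1 (*) (*) 1 L \<and> algebra_map sA (*) 1 (*) (*) 1 l \<and>
     Vector_Spaces.linear sA sA D \<and> Vector_Spaces.linear sA sA d \<and>
     L a0 = l a0 \<and> D a0 = d a0 \<and> (\<forall>a. l (d a) = 0) \<and> (\<forall>a. L (D a) = 0) \<and>
     (\<forall>a b. d (a * b) = a * d b + sA (l b) (d a)) \<and>
     (\<forall>a b. D (a * b) = sA (L a) (D b) + D a * b) \<and>
     (\<forall>a. d (d a) = sA u (d a) + a * a0 - sA (l a) a0) \<and>
     (\<forall>a. D (D a) = sA u (D a) + a0 * a - sA (L a) a0) \<and>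
     (\<forall>a. D (d a) - d (D a) = sA (L a - l a) a0) \<and>
     (\<forall>a. L (d a) - l (D a) = (L a - l a) * u) \<and>
     (\<forall>a b. a * D b + sA (L b) (d a) = d a * b + sA (l a) (D b))}"

fun flag_related ::
  "('k::field \<Rightarrow> 'a::{ring,monoid_mult} \<Rightarrow> 'a) \<Rightarrow> 'k \<Rightarrow> 'a \<Rightarrow> ('k, 'a) flag \<Rightarrow> ('k, 'a) flag \<Rightarrow> bool" where
  "flag_related sA q \<alpha> (L, l, D, d, a0, u) (L', l', D', d', a0', u') \<longleftrightarrow>
     (\<forall>a. D a = sA q (D' a) + \<alpha> * a - sA (L a) \<alpha>) \<and>
     (\<forall>a. d a = sA q (d' a) + a * \<alpha> - sA (l a) \<alpha>) \<and>
     a0 = sA (q^2) a0' + \<alpha>^2 - sA u \<alpha> + sA q (d' \<alpha>) + sA q (D' \<alpha>) \<and>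
     u = q * u' + l' \<alpha> + L' \<alpha>"

definition flag_equiv ::
  "('k::field \<Rightarrow> 'a::{ring,monoid_mult} \<Rightarrow> 'a) \<Rightarrow> (('k, 'a) flag \<times> ('k, 'a) flag) set" where
  "flag_equiv sA = {((L, l, D, d, a0, u), (L', l', D', d', a0', u')).
     (L, l, D, d, a0, u) \<in> flag_datums sA \<and> (L', l', D', d', a0', u') \<in> flag_datums sA \<and>
     L = L' \<and> l = l' \<and>
     (\<exists>q \<alpha>. q \<noteq> 0 \<and>
        flag_related sA q \<alpha> (L, l, D, d, a0, u) (L', l', D', d', a0', u'))}"

definition flag_approx ::
  "('k::field \<Rightarrow> 'a::{ring,monoid_mult} \<Rightarrow> 'a) \<Rightarrow> (('k, 'a) flag \<times> ('k, 'a) flag) set" where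
  "flag_approx sA = {((L, l, D, d, a0, u), (L', l', D', d', a0', u')).
     (L, l, D, d, a0, u) \<in> flag_datums sA \<and> (L', l', D', d', a0', u') \<in> flag_datums sA \<and>
     L = L' \<and> l = l' \<and>
     (\<exists>\<alpha>. flag_related sA 1 \<alpha> (L, l, D, d, a0, u) (L', l', D', d', a0', u'))}"

text \<open>
  The product \<open>(a + sx)(b + tx)\<close> expanded by bilinearity from the product of \<open>A\<close> and
  \<open>x\<^sup>2 = a0 + u x\<close>, \<open>ax = d a + l a x\<close>, \<open>xa = D a + L a x\<close>, where \<open>(a, s)\<close> encodes \<open>a + sx\<close>.
\<close>

fun flag_mult ::
  "('k::field \<Rightarrow> 'a::{ring,monoid_mult} \<Rightarrow> 'a) \<Rightarrow> ('k, 'a) flag \<Rightarrow> 'a \<times> 'k \<Rightarrow> 'a \<times> 'k \<Rightarrow> 'a \<times> 'k" where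
  "flag_mult sA (L, l, D, d, a0, u) (a, s) (b, t) =
     (a * b + sA t (d a) + sA s (D b) + sA (s * t) a0, t * l a + s * L b + s * t * u)"


section \<open>Transport to the ambient space\<close>

text \<open>The identification of \<open>A \<times> k\<close> with \<open>E = A \<oplus> kx\<close>, and transport of multiplications along it.\<close>

definition to_E ::
  "('k \<Rightarrow> 'e::ab_group_add \<Rightarrow> 'e) \<Rightarrow> ('a \<Rightarrow> 'e) \<Rightarrow> 'e \<Rightarrow> 'a \<times> 'k \<Rightarrow> 'e" where
  "to_E sE \<iota> x = (\<lambda>(a, s). \<iota> a + sE s x)"

definition transport :: "('b \<Rightarrow> 'e) \<Rightarrow> ('b \<Rightarrow> 'b \<Rightarrow> 'b) \<Rightarrow> 'e \<Rightarrow> 'e \<Rightarrow> 'e" where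
  "transport \<psi> m = (\<lambda>e e'. \<psi> (m (inv \<psi> e) (inv \<psi> e')))"

definition flag_algebra ::
  "('k::field \<Rightarrow> 'a::{ring,monoid_mult} \<Rightarrow> 'a) \<Rightarrow> ('k \<Rightarrow> 'e::ab_group_add \<Rightarrow> 'e) \<Rightarrow>
   ('a \<Rightarrow> 'e) \<Rightarrow> 'e \<Rightarrow> ('k, 'a) flag \<Rightarrow> 'e \<Rightarrow> 'e \<Rightarrow> 'e" where
  "flag_algebra sA sE \<iota> x F = transport (to_E sE \<iota> x) (flag_mult sA F)"

definition unified_algebra ::
  "('k::field \<Rightarrow> 'e::ab_group_add \<Rightarrow> 'e) \<Rightarrow> ('a::{ring,monoid_mult} \<Rightarrow> 'e) \<Rightarrow> 'e \<Rightarrow>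
   ('a, 'k) ext_system \<Rightarrow> 'e \<Rightarrow> 'e \<Rightarrow> 'e" where
  "unified_algebra sE \<iota> x S = transport (to_E sE \<iota> x) (unified_mult S)"

end

(* A linear automorphism of E = A + kx that fixes A pointwise has the form a + s x |-> a + s (alpha + q x)
   with q nonzero, and it fixes the projection to kx exactly if q = 1.  The flag datum axioms express
   associativity of the product with prescribed x^2, ax and xa, so flag datums, extending systems on A x k
   and algebra structures on E are the same objects; and each of the three equivalence relations says that
   such an automorphism is multiplicative. *)
theory Submission
  imports Defs "HOL-Library.Product_Plus"
begin

text \<open>Composing and inverting the formulas for (q, \<alpha>) by hand, in order to see that
  \<open>flag_equiv\<close> and \<open>flag_approx\<close> are symmetric and transitive, is
  laborious. Only the relations on algebra structures are therefore shown to be equivalences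
  directly, where isomorphisms compose and invert; the other relations inherit this by pullback. The
  pullback is possible because the bijections exist already between the sets of flag datums,
  extending systems and algebra structures, before any quotient is formed. All comparisons take
  place on A x k, where the formulas with q and \<alpha> come from comparing the images of ax, xa
  and x^2 when x is sent to \<alpha> + q x.\<close>

lemma linear_simps:
  assumes "Vector_Spaces.linear s1 s2 f"
  shows "f (x + y) = f x + f y" "f (s1 c x) = s2 c (f x)" "f 0 = 0" "f (- x) = - f x"
    "f (x - y) = f x - f y"
proof -
  interpret Vector_Spaces.linear s1 s2 f by (fact assms)
  show "f (x + y) = f x + f y" "f (s1 c x) = s2 c (f x)" "f 0 = 0" "f (- x) = - f x"
    "f (x - y) = f x - f y"
    by (simp_all add: add scale neg diff)
qed

lemma vector_space_field: "vector_space ((*) :: 'k::field \<Rightarrow> 'k \<Rightarrow> 'k)"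
  by unfold_locales (simp_all add: algebra_simps)

lemma linear_from_field:
  assumes "Vector_Spaces.linear (*) s f"
  shows "f c = s c (f 1)"
  using linear_simps(2)[OF assms, of c 1] by simp

section \<open>Flag datums and associativity on A x k\<close>

locale unital_algebra_over_field =
  fixes sA :: "'k::field \<Rightarrow> 'a::{ring,monoid_mult} \<Rightarrow> 'a"
  assumes unital_algebra: "unital_algebra sA (*) 1"
begin

sublocale vector_space sA
  using unital_algebra by (simp add: unital_algebra_def)

lemma scale_mult [simp]: "sA c a * b = sA c (a * b)" "a * sA c b = sA c (a * b)"
  using unital_algebra by (auto simp: unital_algebra_def bilinear_map_def dest: linear_simps(2))

text \<open>By trilinearity only triples with entries in A or equal to x matter. The triple xxx
  gives the conditions on a0; abx and xab give the product rules for d, D and the multiplicativity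
  of l, L; axb gives the exchange law of D and d; axx and xxa give the formulas for d^2 and D^2
  together with the vanishing of l d and L D; xax gives the two mixed conditions.\<close>

lemma flag_datums_iff_assoc_with_unit:
  assumes L: "Vector_Spaces.linear sA (*) L" and l: "Vector_Spaces.linear sA (*) l"
    and D: "Vector_Spaces.linear sA sA D" and d: "Vector_Spaces.linear sA sA d"
  shows "(L, l, D, d, a0, u) \<in> flag_datums sA \<longleftrightarrow>
    assoc_with_unit (flag_mult sA (L, l, D, d, a0, u)) (1, 0)" (is "?F \<longleftrightarrow> ?M")
proof -
  note [simp] = linear_simps[OF L] linear_simps[OF l] linear_simps[OF D] linear_simps[OF d]
  have ?M if ?F
  proof -
    from that have unit: "L 1 = 1" "l 1 = 1"
      and mult: "\<And>a b. L (a * b) = L a * L b" "\<And>a b. l (a * b) = l a * l b"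
      and a0: "L a0 = l a0" "D a0 = d a0" and zero: "\<And>a. l (d a) = 0" "\<And>a. L (D a) = 0"
      and d_mult: "\<And>a b. d (a * b) = a * d b + sA (l b) (d a)"
      and D_mult: "\<And>a b. D (a * b) = sA (L a) (D b) + D a * b"
      and dd: "\<And>a. d (d a) = sA u (d a) + a * a0 - sA (l a) a0"
      and DD: "\<And>a. D (D a) = sA u (D a) + a0 * a - sA (L a) a0"
      and Dd: "\<And>a. D (d a) - d (D a) = sA (L a - l a) a0"
      and Ld: "\<And>a. L (d a) - l (D a) = (L a - l a) * u"
      and mid: "\<And>a b. a * D b + sA (L b) (d a) = d a * b + sA (l a) (D b)"
      by (auto simp: flag_datums_def algebra_map_def)
    \<comment> \<open>The mixed conditions and the exchange law are solved for one term each, so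
      that they can be used as rewrite rules.\<close>
    have Dd': "D (d a) = d (D a) + sA (L a - l a) a0" for a
      using Dd[of a] by (simp add: algebra_simps)
    have Ld': "L (d a) = l (D a) + (L a - l a) * u" for a
      using Ld[of a] by (simp add: algebra_simps)
    have mid': "a * D b = d a * b + sA (l a) (D b) - sA (L b) (d a)" for a b
      using mid[of a b] by (simp add: algebra_simps)
    \<comment> \<open>The unit law for x needs these values. They follow from the product rules at 1
      * 1, which read y = y + y because L and l are 1 there.\<close>
    have "D 1 = 0" "d 1 = 0"
      using D_mult[of 1 1] d_mult[of 1 1] by (simp_all add: unit)
    then show ?thesis
      unfolding assoc_with_unit_def
      by (auto simp: unit mult a0 zero d_mult D_mult dd DD Dd' Ld' mid' algebra_simps)
  qed
  moreover have ?F if ?M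
  proof -
    let ?m = "flag_mult sA (L, l, D, d, a0, u)"
    from that have assoc: "?m (?m p p') p'' = ?m p (?m p' p'')"
      and unit: "?m (1, 0) p = p" "?m p (1, 0) = p" for p p' p''
      unfolding assoc_with_unit_def by blast+
    have "L 1 = 1" "l 1 = 1"
      using unit[of "(0, 1)"] by auto
    then show ?thesis
      using assoc[of "(0, 1)" "(0, 1)" "(0, 1)"]
        assoc[of "(a, 0)" "(b, 0)" "(0, 1)" for a b] assoc[of "(0, 1)" "(a, 0)" "(b, 0)" for a b]
        assoc[of "(a, 0)" "(0, 1)" "(b, 0)" for a b]
        assoc[of "(a, 0)" "(0, 1)" "(0, 1)" for a] assoc[of "(0, 1)" "(0, 1)" "(a, 0)" for a]
        assoc[of "(0, 1)" "(a, 0)" "(0, 1)" for a]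
      by (simp add: flag_datums_def algebra_map_def assms algebra_simps)
  qed
  ultimately show ?thesis by blast
qed

end

section \<open>Relations between systems as multiplicative maps\<close>

definition multiplicative :: "('b \<Rightarrow> 'b \<Rightarrow> 'b) \<Rightarrow> ('c \<Rightarrow> 'c \<Rightarrow> 'c) \<Rightarrow> ('b \<Rightarrow> 'c) \<Rightarrow> bool" where
  "multiplicative m m' h \<longleftrightarrow> (\<forall>p p'. h (m p p') = m' (h p) (h p'))"

lemma multiplicativeD: "multiplicative m m' h \<Longrightarrow> h (m p p') = m' (h p) (h p')"
  by (simp add: multiplicative_def)

text \<open>Coordinate form of a linear map of E that fixes A pointwise: \<open>\<alpha>\<close> and
  \<open>q\<close> are the coordinates of the image of x.\<close>

fun shear :: "('k::field \<Rightarrow> 'a::ab_group_add \<Rightarrow> 'a) \<Rightarrow> 'k \<Rightarrow> 'a \<Rightarrow> 'a \<times> 'k \<Rightarrow> 'a \<times> 'k" where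
  "shear sA q \<alpha> (a, s) = (a + sA s \<alpha>, q * s)"

text \<open>For V = k a map that is linear in an argument from V is determined by its value at 1; a
  flag datum collects these values.\<close>

fun flag_ext :: "('k::field \<Rightarrow> 'a::{ring,monoid_mult} \<Rightarrow> 'a) \<Rightarrow> ('k, 'a) flag \<Rightarrow> ('a, 'k) ext_system" where
  "flag_ext sA (L, l, D, d, a0, u) =
     (\<lambda>s a. s * L a, \<lambda>s a. sA s (D a), \<lambda>a s. sA s (d a), \<lambda>a s. s * l a,
      \<lambda>s t. sA (s * t) a0, \<lambda>s t. s * t * u)"

text \<open>The formulas of \<open>ext_related\<close> are the multiplicativity equations solved for
  the primed operations. These are naturally evaluated at images under v, whence the inverse of v in
  the formulas.\<close>

lemma ext_related_iff_multiplicative: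
  assumes S: "(lt, rt, lh, rh, f, dt) \<in> AE sA sV" and S': "(lt', rt', lh', rh', f', dt') \<in> AE sA sV"
    and r: "Vector_Spaces.linear sV sA r" and v: "Vector_Spaces.linear sV sV v" and "bij v"
  shows "ext_related r v (lt, rt, lh, rh, f, dt) (lt', rt', lh', rh', f', dt') \<longleftrightarrow>
    multiplicative (unified_mult (lt, rt, lh, rh, f, dt)) (unified_mult (lt', rt', lh', rh', f', dt'))
      (\<lambda>(a, x). (a + r x, v x))" (is "?E \<longleftrightarrow> ?M")
proof -
  note [simp] = linear_simps(1,3,4,5)[OF r] linear_simps(1,3,4,5)[OF v]
    bij_is_inj[OF \<open>bij v\<close>, THEN inv_f_f] bij_is_surj[OF \<open>bij v\<close>, THEN surj_f_inv_f]
  have add: "lt' x (a + b) = lt' x a + lt' x b" "rt' x (a + b) = rt' x a + rt' x b"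
    "lh' (a + b) x = lh' a x + lh' b x" "rh' (a + b) x = rh' a x + rh' b x" for a b x
    using S' by (auto simp: AE_def bilinear_map_def dest: linear_simps(1))
  have add0: "lh (a + b) x = lh a x + lh b x" "rh (a + b) x = rh a x + rh b x" for a b x
    using S by (auto simp: AE_def bilinear_map_def dest: linear_simps(1))
  have zero [simp]: "lt x 0 = 0" "lt 0 a = 0" "rt x 0 = 0" "rt 0 a = 0" "lh a 0 = 0" "lh 0 x = 0"
    "rh a 0 = 0" "rh 0 x = 0" "f x 0 = 0" "f 0 x = 0" "dt x 0 = 0" "dt 0 x = 0" for a x
    using S by (auto simp: AE_def bilinear_map_def dest: linear_simps(3))
  have zero' [simp]: "lt' x 0 = 0" "lt' 0 a = 0" "rt' x 0 = 0" "rt' 0 a = 0" "lh' a 0 = 0" "lh' 0 x = 0"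
    "rh' a 0 = 0" "rh' 0 x = 0" "f' x 0 = 0" "f' 0 x = 0" "dt' x 0 = 0" "dt' 0 x = 0" for a x
    using S' by (auto simp: AE_def bilinear_map_def dest: linear_simps(3))
  have ?M if ?E
  proof -
    \<comment> \<open>At arguments \<open>v x\<close> and \<open>v y\<close> the inverse of v
      cancels, and each primed operation on images is expressed by unprimed ones.\<close>
    have *: "rh' a (v x) = v (rh a x)" "lh' a (v x) = r (rh a x) - a * r x + lh a x"
      "lt' (v x) a = v (lt x a)" "rt' (v x) a = r (lt x a) - r x * a + rt x a"
      "dt' (v x) (v y) = v (dt x y) - v (rh (r x) y) - v (lt x (r y))"
      "f' (v x) (v y) = r (dt x y) + f x y - r (rh (r x) y) - lh (r x) y - r (lt x (r y))
        + r x * r y - rt x (r y)" for a x y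
      using that by (simp_all add: Let_def)
    show ?thesis
      by (auto simp: multiplicative_def add add0 * algebra_simps)
  qed
  moreover have ?E if ?M
  proof -
    let ?w = "inv v"
    have rh: "rh' a x = v (rh a (?w x))" and lh: "lh' a x = r (rh a (?w x)) - a * r (?w x) + lh a (?w x)"
      for a x
      using multiplicativeD[OF that, of "(a, 0)" "(0, ?w x)"] by (auto simp: algebra_simps)
    have lt: "lt' x a = v (lt (?w x) a)" and rt: "rt' x a = r (lt (?w x) a) - r (?w x) * a + rt (?w x) a"
      for a x
      using multiplicativeD[OF that, of "(0, ?w x)" "(a, 0)"] by (auto simp: algebra_simps)
    \<comment> \<open>The product of two images of vectors from V still contains the primed actions
      on \<open>r (w x)\<close> and \<open>r (w y)\<close>; the four formulas above eliminate them.
      Two of these actions contribute \<open>- r (w x) * r (w y)\<close> each, against one such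
      product with sign plus, so solving for f' leaves it with sign plus.\<close>
    show ?thesis
      using multiplicativeD[OF that, of "(0, ?w x)" "(0, ?w y)" for x y]
      by (auto simp: Let_def rh lh lt rt algebra_simps)
  qed
  ultimately show ?thesis by blast
qed

lemma unified_mult_flag_ext: "unified_mult (flag_ext sA F) = flag_mult sA F"
  by (cases F) (auto simp: fun_eq_iff algebra_simps)

context unital_algebra_over_field
begin

text \<open>The products ax, xa and x^2 account for (d, l), (D, L) and (a0, u) in turn. Their line
  coordinates also force L = L' and l = l', which \<open>flag_related\<close> does not contain and
  which are therefore added on the left.\<close>

lemma flag_related_iff_multiplicative:
  assumes F: "(L, l, D, d, a0, u) \<in> flag_datums sA" and F': "(L', l', D', d', a0', u') \<in> flag_datums sA"
    and "q \<noteq> 0"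
  shows "L = L' \<and> l = l' \<and> flag_related sA q \<alpha> (L, l, D, d, a0, u) (L', l', D', d', a0', u') \<longleftrightarrow>
    multiplicative (flag_mult sA (L, l, D, d, a0, u)) (flag_mult sA (L', l', D', d', a0', u'))
      (shear sA q \<alpha>)" (is "?E \<longleftrightarrow> ?M")
proof -
  have L: "Vector_Spaces.linear sA (*) L" and l: "Vector_Spaces.linear sA (*) l"
    and D: "Vector_Spaces.linear sA sA D" and d: "Vector_Spaces.linear sA sA d"
    using F by (auto simp: flag_datums_def algebra_map_def)
  have L': "Vector_Spaces.linear sA (*) L'" and l': "Vector_Spaces.linear sA (*) l'"
    and D': "Vector_Spaces.linear sA sA D'" and d': "Vector_Spaces.linear sA sA d'"
    using F' by (auto simp: flag_datums_def algebra_map_def)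
  note [simp] = linear_simps[OF L] linear_simps[OF l] linear_simps[OF D] linear_simps[OF d]
    linear_simps[OF L'] linear_simps[OF l'] linear_simps[OF D'] linear_simps[OF d']
  have ?M if E: ?E
  proof -
    have 1: "D a = sA q (D' a) + \<alpha> * a - sA (L' a) \<alpha>" "d a = sA q (d' a) + a * \<alpha> - sA (l' a) \<alpha>"
      "a0 = sA (q^2) a0' + \<alpha>^2 - sA u \<alpha> + sA q (d' \<alpha>) + sA q (D' \<alpha>)"
      "L a = L' a" "l a = l' a" for a
      using E by auto
    have u: "u = q * u' + l' \<alpha> + L' \<alpha>"
      using E by auto
    show ?thesis
      unfolding multiplicative_def
      by (auto simp: 1 u power2_eq_square algebra_simps)
  qed
  moreover have ?E if ?M
  proof -
    \<comment> \<open>The line coordinate only says that q times \<open>l a\<close> equals q times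
      \<open>l' a\<close>; a nonzero q can be cancelled. The same happens below for L and u.\<close>
    have d: "d a = sA q (d' a) + a * \<alpha> - sA (l a) \<alpha>" and l: "l a = l' a" for a
      using multiplicativeD[OF that, of "(a, 0)" "(0, 1)"] \<open>q \<noteq> 0\<close>
      by (auto simp: algebra_simps)
    have D: "D a = sA q (D' a) + \<alpha> * a - sA (L a) \<alpha>" and L: "L a = L' a" for a
      using multiplicativeD[OF that, of "(0, 1)" "(a, 0)"] \<open>q \<noteq> 0\<close>
      by (auto simp: algebra_simps)
    have "a0 + sA u \<alpha> = \<alpha> * \<alpha> + sA q (d' \<alpha>) + sA q (D' \<alpha>) + sA (q * q) a0'"
      and "q * u = q * (q * u' + l' \<alpha> + L' \<alpha>)"
      using multiplicativeD[OF that, of "(0, 1)" "(0, 1)"] by (auto simp: algebra_simps)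
    moreover from this have "u = q * u' + l' \<alpha> + L' \<alpha>"
      using \<open>q \<noteq> 0\<close> by (metis mult_left_cancel)
    ultimately show ?thesis
      using d D l L by (auto simp: power2_eq_square algebra_simps)
  qed
  ultimately show ?thesis by blast
qed

end

section \<open>Quotients along bijections that respect relations\<close>

lemma quotient_bij:
  assumes h: "bij_betw h X Y" and S: "equiv Y S" and R: "R \<subseteq> X \<times> X"
    and rel: "\<And>a b. a \<in> X \<Longrightarrow> b \<in> X \<Longrightarrow> (a, b) \<in> R \<longleftrightarrow> (h a, h b) \<in> S"
  shows "equiv X R" "\<exists>\<Psi>. bij_betw \<Psi> (X // R) (Y // S) \<and> (\<forall>a\<in>X. \<Psi> (R `` {a}) = S `` {h a})"
proof -
  have hX: "h a \<in> Y" if "a \<in> X" for a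
    using h that by (auto simp: bij_betw_def)
  show equiv: "equiv X R"
  proof (rule equivI)
    show "refl_on X R"
      by (rule refl_onI) (use R hX S rel in \<open>auto simp: equiv_def refl_on_def\<close>)
    show "sym R"
      by (rule symI) (use R S rel in \<open>blast elim: equivE dest: symD\<close>)
    show "trans R"
      by (rule transI) (use R S rel in \<open>blast elim: equivE dest: transD\<close>)
  qed (fact R)
  \<comment> \<open>Saturating the image of a class avoids choosing a representative, and gives the
    class of \<open>h a\<close> for each member a.\<close>
  define \<Psi> where "\<Psi> C = S `` (h ` C)" for C
  have \<Psi>: "\<Psi> (R `` {a}) = S `` {h a}" if "a \<in> X" for a
  proof -
    have "S `` {h b} = S `` {h a}" if "(a, b) \<in> R" for b
      using that R rel[of a b] equiv_class_eq[OF S, of "h a" "h b"] by auto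
    moreover have "(a, a) \<in> R"
      using equiv that by (auto simp: equiv_def refl_on_def)
    ultimately show ?thesis
      by (fastforce simp: \<Psi>_def)
  qed
  have "bij_betw \<Psi> (X // R) (Y // S)"
  proof (rule bij_betw_imageI)
    show "inj_on \<Psi> (X // R)"
    proof (rule inj_onI)
      fix C C' assume "C \<in> X // R" "C' \<in> X // R" and eq: "\<Psi> C = \<Psi> C'"
      then obtain a b where C: "C = R `` {a}" "C' = R `` {b}" and ab: "a \<in> X" "b \<in> X"
        by (auto elim!: quotientE)
      have "(h a, h b) \<in> S"
        using eq ab hX \<Psi> eq_equiv_class_iff[OF S, of "h a" "h b"] by (simp add: C)
      then show "C = C'"
        using ab rel equiv_class_eq[OF equiv] by (simp add: C)
    qed
    have "\<Psi> ` (X // R) = (\<lambda>a. S `` {h a}) ` X"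
      using \<Psi> by (force simp: quotient_def image_iff)
    also have "\<dots> = (\<lambda>b. S `` {b}) ` (h ` X)"
      by (simp add: image_image)
    also have "\<dots> = Y // S"
      using h by (auto simp: bij_betw_def quotient_def)
    finally show "\<Psi> ` (X // R) = Y // S" .
  qed
  then show "\<exists>\<Psi>. bij_betw \<Psi> (X // R) (Y // S) \<and> (\<forall>a\<in>X. \<Psi> (R `` {a}) = S `` {h a})"
    using \<Psi> by blast
qed

text \<open>Equivalence is assumed for the last relation T alone: pulled back along h it makes S an
  equivalence, and S pulled back along g does the same for R.\<close>

lemma quotient_bij_comp:
  assumes g: "bij_betw g X Y" and h: "bij_betw h Y Z" and T: "equiv Z T"
    and R: "R \<subseteq> X \<times> X" and S: "S \<subseteq> Y \<times> Y"
    and relg: "\<And>a b. a \<in> X \<Longrightarrow> b \<in> X \<Longrightarrow> (a, b) \<in> R \<longleftrightarrow> (g a, g b) \<in> S"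
    and relh: "\<And>a b. a \<in> Y \<Longrightarrow> b \<in> Y \<Longrightarrow> (a, b) \<in> S \<longleftrightarrow> (h a, h b) \<in> T"
  shows "equiv X R \<and> (\<exists>\<Psi> \<Theta>. bij_betw \<Psi> (Y // S) (Z // T) \<and> (\<forall>a\<in>Y. \<Psi> (S `` {a}) = T `` {h a}) \<and>
    bij_betw \<Theta> (X // R) (Y // S) \<and> bij_betw (\<Psi> \<circ> \<Theta>) (X // R) (Z // T) \<and>
    (\<forall>a\<in>X. (\<Psi> \<circ> \<Theta>) (R `` {a}) = T `` {h (g a)}))"
proof -
  have equiv: "equiv Y S"
    by (rule quotient_bij(1)[OF h T S relh])
  obtain \<Psi> where \<Psi>: "bij_betw \<Psi> (Y // S) (Z // T)" "\<And>a. a \<in> Y \<Longrightarrow> \<Psi> (S `` {a}) = T `` {h a}"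
    using quotient_bij(2)[OF h T S relh] by blast
  obtain \<Theta> where \<Theta>: "bij_betw \<Theta> (X // R) (Y // S)" "\<And>a. a \<in> X \<Longrightarrow> \<Theta> (R `` {a}) = S `` {g a}"
    using quotient_bij(2)[OF g equiv R relg] by blast
  have "(\<Psi> \<circ> \<Theta>) (R `` {a}) = T `` {h (g a)}" if "a \<in> X" for a
    using that \<Theta>(2) \<Psi>(2) bij_betw_apply[OF g] by simp
  then show ?thesis
    using quotient_bij(1)[OF g equiv R relg] \<Psi> \<Theta> bij_betw_trans[OF \<Theta>(1) \<Psi>(1)] by blast
qed

section \<open>Transport of structure along a linear bijection\<close>

lemma linear_inv:
  assumes \<psi>: "Vector_Spaces.linear s1 s2 \<psi>" "bij \<psi>"
  shows "Vector_Spaces.linear s2 s1 (inv \<psi>)"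
proof -
  have "vector_space s1" "vector_space s2"
    using \<psi>(1) by (auto simp: Vector_Spaces.linear_iff)
  moreover have "inv \<psi> (y + z) = inv \<psi> y + inv \<psi> z" "inv \<psi> (s2 c y) = s1 c (inv \<psi> y)" for y z c
    using \<psi>(2) by (auto simp: inv_f_eq bij_is_inj bij_is_surj surj_f_inv_f linear_simps[OF \<psi>(1)])
  ultimately show ?thesis
    by (simp add: Vector_Spaces.linear_iff)
qed

lemma bilinear_map_transport:
  assumes \<psi>: "Vector_Spaces.linear s1 s2 \<psi>" "bij \<psi>" and m: "bilinear_map s1 s1 s1 m"
  shows "bilinear_map s2 s2 s2 (transport \<psi> m)"
proof -
  have "Vector_Spaces.linear s2 s2 (\<psi> \<circ> (h \<circ> inv \<psi>))" if "Vector_Spaces.linear s1 s1 h" for h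
    by (intro Vector_Spaces.linear_compose[OF _ \<psi>(1)] Vector_Spaces.linear_compose[OF _ that] linear_inv \<psi>)
  then show ?thesis
    using m unfolding bilinear_map_def transport_def comp_def by blast
qed

lemma transport_inv:
  assumes "bij \<psi>"
  shows "transport \<psi> (transport (inv \<psi>) m) = m"
  unfolding transport_def inv_inv_eq[OF assms] surj_f_inv_f[OF bij_is_surj[OF assms]] by (rule refl)

lemma transport_eq_iff:
  assumes "bij \<psi>"
  shows "transport \<psi> m = transport \<psi> m' \<longleftrightarrow> m = m'"
proof -
  have "transport (inv \<psi>) (transport \<psi> m) = m" for m
    unfolding transport_def inv_inv_eq[OF assms] inv_f_f[OF bij_is_inj[OF assms]] by (rule refl)
  then show ?thesis by metis
qed

text \<open>Conjugation by \<psi> turns maps of the source into maps of the target, so isomorphisms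
  of structures on E can be tested on A x k.\<close>

lemma multiplicative_transport:
  assumes "bij \<psi>"
  shows "multiplicative (transport \<psi> m) (transport \<psi> m') (\<psi> \<circ> h \<circ> inv \<psi>) \<longleftrightarrow> multiplicative m m' h"
proof -
  note [simp] = bij_is_inj[OF assms, THEN inv_f_f] bij_is_inj[OF assms, THEN inj_eq]
  have "multiplicative (transport \<psi> m) (transport \<psi> m') (\<psi> \<circ> h \<circ> inv \<psi>) \<longleftrightarrow>
      (\<forall>e e'. h (m (inv \<psi> e) (inv \<psi> e')) = m' (h (inv \<psi> e)) (h (inv \<psi> e')))"
    by (simp add: multiplicative_def transport_def)
  also have "\<dots> \<longleftrightarrow> multiplicative m m' h"
    unfolding multiplicative_def using bij_is_inj[OF assms, THEN inv_f_f] by metis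
  finally show ?thesis .
qed

lemma assoc_with_unit_transport:
  assumes "bij \<psi>"
  shows "assoc_with_unit (transport \<psi> m) (\<psi> e) \<longleftrightarrow> assoc_with_unit m e"
proof -
  note [simp] = bij_is_inj[OF assms, THEN inv_f_f] bij_is_inj[OF assms, THEN inj_eq]
    bij_is_surj[OF assms, THEN surj_f_inv_f]
  have unit: "\<psi> b = x \<longleftrightarrow> b = inv \<psi> x" for b x
    by auto
  \<comment> \<open>Reindexing along the bijection; it is applied to one quantifier at a
    time.\<close>
  have all: "(\<forall>x. P (inv \<psi> x)) \<longleftrightarrow> (\<forall>y. P y)" for P
    using bij_is_inj[OF assms, THEN inv_f_f] by metis
  have "assoc_with_unit (transport \<psi> m) (\<psi> e) \<longleftrightarrow>
      (\<forall>x y z. m (m (inv \<psi> x) (inv \<psi> y)) (inv \<psi> z) = m (inv \<psi> x) (m (inv \<psi> y) (inv \<psi> z))) \<and>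
      (\<forall>x. m e (inv \<psi> x) = inv \<psi> x \<and> m (inv \<psi> x) e = inv \<psi> x)"
    by (simp add: assoc_with_unit_def transport_def unit)
  also have "\<dots> \<longleftrightarrow> assoc_with_unit m e"
    unfolding assoc_with_unit_def
    using all[of "\<lambda>x. m e x = x \<and> m x e = x"]
      all[of "\<lambda>x. \<forall>y z. m (m x (inv \<psi> y)) (inv \<psi> z) = m x (m (inv \<psi> y) (inv \<psi> z))"]
      all[of "\<lambda>y. \<forall>z. m (m x y) (inv \<psi> z) = m x (m y (inv \<psi> z))" for x]
      all[of "\<lambda>z. m (m x y) z = m x (m y z)" for x y] by simp
  finally show ?thesis .
qed

section \<open>Bilinear products on A x k\<close>

definition scale_prod :: "('k \<Rightarrow> 'a \<Rightarrow> 'a) \<Rightarrow> 'k \<Rightarrow> 'a \<times> 'k::field \<Rightarrow> 'a \<times> 'k" where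
  "scale_prod sA c p = (sA c (fst p), c * snd p)"

context unital_algebra_over_field
begin

lemma vector_space_scale_prod: "vector_space (scale_prod sA)"
  by unfold_locales
    (simp_all add: scale_prod_def prod_eq_iff scale_left_distrib scale_right_distrib distrib_left
      distrib_right mult.assoc)

lemma bilinear_map_flag_mult:
  assumes L: "Vector_Spaces.linear sA (*) L" and l: "Vector_Spaces.linear sA (*) l"
    and D: "Vector_Spaces.linear sA sA D" and d: "Vector_Spaces.linear sA sA d"
  shows "bilinear_map (scale_prod sA) (scale_prod sA) (scale_prod sA) (flag_mult sA (L, l, D, d, a0, u))"
  by (auto simp: bilinear_map_def Vector_Spaces.linear_iff vector_space_scale_prod scale_prod_def
      linear_simps[OF L] linear_simps[OF l] linear_simps[OF D] linear_simps[OF d] algebra_simps)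

text \<open>The six components are the coordinates of xa, ax and x^2, so the product determines the
  tuple.\<close>

lemma flag_mult_inject: "flag_mult sA F = flag_mult sA F' \<longleftrightarrow> F = F'"
proof
  assume *: "flag_mult sA F = flag_mult sA F'"
  obtain L l D d a0 u L' l' D' d' a0' u' where F: "F = (L, l, D, d, a0, u)" "F' = (L', l', D', d', a0', u')"
    by (metis prod_cases6)
  have "flag_mult sA F p p' = flag_mult sA F' p p'" for p p'
    using * by simp
  from this[of "(0, 1)" "(a, 0)" for a] this[of "(a, 0)" "(0, 1)" for a] this[of "(0, 1)" "(0, 1)"]
  show "F = F'"
    by (auto simp: F fun_eq_iff)
qed simp

text \<open>A bilinear product that extends the one of A is fixed by xa, ax and x^2, whose
  coordinates supply the tuple. Associativity stays outside, so that it can afterwards be translated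
  into the flag axioms.\<close>

lemma bilinear_map_is_flag_mult:
  assumes m: "bilinear_map (scale_prod sA) (scale_prod sA) (scale_prod sA) m"
    and mult: "\<And>a b. m (a, 0) (b, 0) = (a * b, 0)"
  obtains L l D d a0 u where "m = flag_mult sA (L, l, D, d, a0, u)"
    "Vector_Spaces.linear sA (*) L" "Vector_Spaces.linear sA (*) l"
    "Vector_Spaces.linear sA sA D" "Vector_Spaces.linear sA sA d"
proof
  let ?L = "\<lambda>a. snd (m (0, 1) (a, 0))" and ?l = "\<lambda>a. snd (m (a, 0) (0, 1))"
    and ?D = "\<lambda>a. fst (m (0, 1) (a, 0))" and ?d = "\<lambda>a. fst (m (a, 0) (0, 1))"
    and ?a0 = "fst (m (0, 1) (0, 1))" and ?u = "snd (m (0, 1) (0, 1))"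
  have "Vector_Spaces.linear (scale_prod sA) (scale_prod sA) (m p)"
    "Vector_Spaces.linear (scale_prod sA) (scale_prod sA) (\<lambda>p'. m p' p)" for p
    using m unfolding bilinear_map_def by blast+
  note lin = linear_simps(1,2)[OF this(1)] linear_simps(1,2)[OF this(2)]
  have split: "(a, s) = (a, 0) + scale_prod sA s (0, 1)" for a s
    by (simp add: scale_prod_def)
  show "m = flag_mult sA (?L, ?l, ?D, ?d, ?a0, ?u)"
  proof (intro ext)
    fix p p' :: "'a \<times> 'k"
    obtain a s b t where p: "p = (a, s)" "p' = (b, t)"
      by (cases p, cases p')
    obtain a0 u where xx: "m (0, 1) (0, 1) = (a0, u)"
      by (cases "m (0, 1) (0, 1)")
    have "m p p' = m (a, 0) (b, 0) + (scale_prod sA s (m (0, 1) (b, 0)) +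
        scale_prod sA t (m (a, 0) (0, 1) + scale_prod sA s (m (0, 1) (0, 1))))"
      unfolding p by (subst (1 2) split) (simp only: lin add.assoc)
    then show "m p p' = flag_mult sA (?L, ?l, ?D, ?d, ?a0, ?u) p p'"
      by (simp add: p xx mult scale_prod_def prod_eq_iff algebra_simps)
  qed
  have "(a + b, 0) = (a, 0) + (b, 0 :: 'k)" "(sA c a, 0) = scale_prod sA c (a, 0)" for a b c
    by (simp_all add: scale_prod_def)
  then show "Vector_Spaces.linear sA (*) ?L" "Vector_Spaces.linear sA (*) ?l"
    "Vector_Spaces.linear sA sA ?D" "Vector_Spaces.linear sA sA ?d"
    by (simp_all only: Vector_Spaces.linear_iff vector_space_axioms vector_space_field lin)
      (simp_all add: scale_prod_def)
qed

text \<open>A tuple and its extending system define the same product on A x k, so the flag axioms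
  and the associativity demanded by \<open>AE\<close> coincide. The inverse map evaluates a system
  at the basis vector 1 of k.\<close>

lemma bij_betw_flag_ext: "bij_betw (flag_ext sA) (flag_datums sA) (AE sA (*))"
proof (rule bij_betw_imageI)
  show "inj_on (flag_ext sA) (flag_datums sA)"
    by (rule inj_onI) (metis unified_mult_flag_ext flag_mult_inject)
  show "flag_ext sA ` flag_datums sA = AE sA (*)"
  proof (intro equalityI image_subsetI subsetI)
    fix F assume F: "F \<in> flag_datums sA"
    obtain L l D d a0 u where F_eq: "F = (L, l, D, d, a0, u)"
      by (metis prod_cases6)
    from F have lin: "Vector_Spaces.linear sA (*) L" "Vector_Spaces.linear sA (*) l"
      "Vector_Spaces.linear sA sA D" "Vector_Spaces.linear sA sA d"
      by (auto simp: F_eq flag_datums_def algebra_map_def)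
    have "assoc_with_unit (unified_mult (flag_ext sA F)) (1, 0)"
      unfolding unified_mult_flag_ext using F flag_datums_iff_assoc_with_unit[OF lin] by (simp add: F_eq)
    then show "flag_ext sA F \<in> AE sA (*)"
      using linear_simps[OF lin(1)] linear_simps[OF lin(2)] linear_simps[OF lin(3)] linear_simps[OF lin(4)]
      by (simp add: F_eq AE_def bilinear_map_def Vector_Spaces.linear_iff vector_space_axioms
          vector_space_field algebra_simps)
  next
    fix S assume S: "S \<in> AE sA (*)"
    obtain lt rt lh rh f dt where S_eq: "S = (lt, rt, lh, rh, f, dt)"
      by (metis prod_cases6)
    let ?L = "\<lambda>a. lt 1 a" and ?l = "\<lambda>a. rh a 1" and ?D = "\<lambda>a. rt 1 a" and ?d = "\<lambda>a. lh a 1"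
    let ?F = "(?L, ?l, ?D, ?d, f 1 1, dt 1 1)"
    have lin: "Vector_Spaces.linear sA (*) ?L" "Vector_Spaces.linear sA (*) ?l"
      "Vector_Spaces.linear sA sA ?D" "Vector_Spaces.linear sA sA ?d"
      and bil: "bilinear_map (*) sA (*) lt" "bilinear_map (*) sA sA rt" "bilinear_map sA (*) sA lh"
        "bilinear_map sA (*) (*) rh" "bilinear_map (*) (*) sA f" "bilinear_map (*) (*) (*) dt"
      and assoc: "assoc_with_unit (unified_mult S) (1, 0)"
      using S by (auto simp: S_eq AE_def bilinear_map_def)
    have lin1: "Vector_Spaces.linear (*) (*) (\<lambda>s. lt s a)" "Vector_Spaces.linear (*) sA (\<lambda>s. rt s a)"
      "Vector_Spaces.linear (*) sA (\<lambda>s. lh a s)" "Vector_Spaces.linear (*) (*) (\<lambda>s. rh a s)" for a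
      using bil by (auto simp: bilinear_map_def)
    have lin2: "Vector_Spaces.linear (*) sA (\<lambda>s. f s t)" "Vector_Spaces.linear (*) sA (\<lambda>s. f t s)"
      "Vector_Spaces.linear (*) (*) (\<lambda>s. dt s t)" "Vector_Spaces.linear (*) (*) (\<lambda>s. dt t s)" for t
      using bil by (auto simp: bilinear_map_def)
    have "s * lt 1 a = lt s a" "sA s (rt 1 a) = rt s a" "sA s (lh a 1) = lh a s" "s * rh a 1 = rh a s" for s a
      by (rule lin1[THEN linear_from_field, symmetric])+
    \<comment> \<open>Homogeneity is used in the left argument and then, at 1, in the right
      one.\<close>
    moreover have "sA (s * t) (f 1 1) = f s t" "s * t * dt 1 1 = dt s t" for s t
      using linear_from_field[OF lin2(1), of s t] linear_from_field[OF lin2(2), of 1 t]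
        linear_from_field[OF lin2(3), of s t] linear_from_field[OF lin2(4), of 1 t] by simp_all
    ultimately have ext: "flag_ext sA ?F = S"
      by (simp add: S_eq)
    then have "?F \<in> flag_datums sA"
      using assoc unified_mult_flag_ext[of sA ?F] flag_datums_iff_assoc_with_unit[OF lin] by metis
    with ext show "S \<in> flag_ext sA ` flag_datums sA"
      by blast
  qed
qed

text \<open>A linear map on k is given by its value at 1, so r and v become \<alpha> = r 1 and q = v
  1, and v is bijective exactly if q is nonzero. The identity is the case q = 1.\<close>

lemma AH2A_rel_iff_multiplicative:
  assumes S: "S \<in> AE sA (*)" and S': "S' \<in> AE sA (*)"
  shows "(S, S') \<in> AH2A_rel sA (*) \<longleftrightarrow>
    (\<exists>q \<alpha>. q \<noteq> 0 \<and> multiplicative (unified_mult S) (unified_mult S') (shear sA q \<alpha>))"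
    and "(S, S') \<in> AH2_rel sA (*) \<longleftrightarrow>
    (\<exists>\<alpha>. multiplicative (unified_mult S) (unified_mult S') (shear sA 1 \<alpha>))"
proof -
  have ext: "ext_related r v S S' \<longleftrightarrow> multiplicative (unified_mult S) (unified_mult S') (shear sA (v 1) (r 1))"
    if "Vector_Spaces.linear (*) sA r" "Vector_Spaces.linear (*) (*) v" "bij v" for r v
  proof -
    have "(\<lambda>(a, x). (a + r x, v x)) = shear sA (v 1) (r 1)"
      using linear_from_field[OF that(1), symmetric] linear_from_field[OF that(2), symmetric]
      by (simp add: fun_eq_iff mult.commute[of "v 1"])
    moreover obtain lt rt lh rh f dt lt' rt' lh' rh' f' dt'
      where eq: "S = (lt, rt, lh, rh, f, dt)" "S' = (lt', rt', lh', rh', f', dt')"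
      by (metis prod_cases6)
    ultimately show ?thesis
      using ext_related_iff_multiplicative[OF S[unfolded eq] S'[unfolded eq] that] by (simp only: eq)
  qed
  have r: "Vector_Spaces.linear (*) sA (\<lambda>s. sA s \<alpha>)" for \<alpha>
    by (simp add: Vector_Spaces.linear_iff vector_space_axioms vector_space_field algebra_simps)
  have v: "Vector_Spaces.linear (*) (*) (\<lambda>s. q * s)" for q :: 'k
    by (simp add: Vector_Spaces.linear_iff vector_space_field algebra_simps)
  have bij: "bij (\<lambda>s. q * s)" if "q \<noteq> 0" for q :: 'k
    using that by (intro bij_betw_byWitness[where f' = "\<lambda>s. s / q"]) auto
  have nz: "v 1 \<noteq> 0" if "Vector_Spaces.linear (*) (*) v" "bij v" for v :: "'k \<Rightarrow> 'k"
    using linear_simps(3)[OF that(1)] bij_is_inj[OF that(2)] by (metis injD one_neq_zero)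
  have id: "Vector_Spaces.linear (*) (*) (id :: 'k \<Rightarrow> 'k)"
    by (simp add: Vector_Spaces.linear_iff vector_space_field)
  show "(S, S') \<in> AH2A_rel sA (*) \<longleftrightarrow>
    (\<exists>q \<alpha>. q \<noteq> 0 \<and> multiplicative (unified_mult S) (unified_mult S') (shear sA q \<alpha>))"
  proof
    assume "(S, S') \<in> AH2A_rel sA (*)"
    then obtain r v where "Vector_Spaces.linear (*) sA r" "Vector_Spaces.linear (*) (*) v" "bij v"
      "ext_related r v S S'"
      by (auto simp: AH2A_rel_def)
    with ext nz show "\<exists>q \<alpha>. q \<noteq> 0 \<and> multiplicative (unified_mult S) (unified_mult S') (shear sA q \<alpha>)"
      by blast
  next
    assume "\<exists>q \<alpha>. q \<noteq> 0 \<and> multiplicative (unified_mult S) (unified_mult S') (shear sA q \<alpha>)"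
    then obtain q \<alpha> where "q \<noteq> 0" "multiplicative (unified_mult S) (unified_mult S') (shear sA q \<alpha>)"
      by blast
    then have "ext_related (\<lambda>s. sA s \<alpha>) (\<lambda>s. q * s) S S'"
      using ext[OF r v bij] by simp
    then show "(S, S') \<in> AH2A_rel sA (*)"
      using S S' r v bij[OF \<open>q \<noteq> 0\<close>] unfolding AH2A_rel_def by blast
  qed
  show "(S, S') \<in> AH2_rel sA (*) \<longleftrightarrow>
    (\<exists>\<alpha>. multiplicative (unified_mult S) (unified_mult S') (shear sA 1 \<alpha>))"
  proof
    assume "(S, S') \<in> AH2_rel sA (*)"
    then obtain r where "Vector_Spaces.linear (*) sA r" "ext_related r id S S'"
      by (auto simp: AH2_rel_def)
    then show "\<exists>\<alpha>. multiplicative (unified_mult S) (unified_mult S') (shear sA 1 \<alpha>)"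
      using ext[OF _ id bij_id] by auto
  next
    assume "\<exists>\<alpha>. multiplicative (unified_mult S) (unified_mult S') (shear sA 1 \<alpha>)"
    then obtain \<alpha> where "multiplicative (unified_mult S) (unified_mult S') (shear sA 1 \<alpha>)"
      by blast
    then have "ext_related (\<lambda>s. sA s \<alpha>) id S S'"
      using ext[OF r id bij_id] by simp
    then show "(S, S') \<in> AH2_rel sA (*)"
      using S S' r unfolding AH2_rel_def by blast
  qed
qed

lemma flag_equiv_iff_multiplicative:
  assumes F: "F \<in> flag_datums sA" and F': "F' \<in> flag_datums sA"
  shows "(F, F') \<in> flag_equiv sA \<longleftrightarrow>
    (\<exists>q \<alpha>. q \<noteq> 0 \<and> multiplicative (flag_mult sA F) (flag_mult sA F') (shear sA q \<alpha>))"
    and "(F, F') \<in> flag_approx sA \<longleftrightarrow>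
    (\<exists>\<alpha>. multiplicative (flag_mult sA F) (flag_mult sA F') (shear sA 1 \<alpha>))"
proof -
  obtain L l D d a0 u L' l' D' d' a0' u' where eq: "F = (L, l, D, d, a0, u)" "F' = (L', l', D', d', a0', u')"
    by (metis prod_cases6)
  note * = flag_related_iff_multiplicative[OF F[unfolded eq] F'[unfolded eq]]
  show "(F, F') \<in> flag_equiv sA \<longleftrightarrow>
    (\<exists>q \<alpha>. q \<noteq> 0 \<and> multiplicative (flag_mult sA F) (flag_mult sA F') (shear sA q \<alpha>))"
    unfolding eq using F F' * by (simp only: flag_equiv_def eq mem_Collect_eq prod.case) blast
  show "(F, F') \<in> flag_approx sA \<longleftrightarrow>
    (\<exists>\<alpha>. multiplicative (flag_mult sA F) (flag_mult sA F') (shear sA 1 \<alpha>))"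
    unfolding eq using F F' *[of 1] by (simp only: flag_approx_def eq mem_Collect_eq prod.case) auto
qed

lemma flag_ext_related_iff:
  assumes "F \<in> flag_datums sA" "F' \<in> flag_datums sA"
  shows "(F, F') \<in> flag_equiv sA \<longleftrightarrow> (flag_ext sA F, flag_ext sA F') \<in> AH2A_rel sA (*)"
    and "(F, F') \<in> flag_approx sA \<longleftrightarrow> (flag_ext sA F, flag_ext sA F') \<in> AH2_rel sA (*)"
  using flag_equiv_iff_multiplicative[OF assms]
    AH2A_rel_iff_multiplicative[OF assms[THEN bij_betw_apply[OF bij_betw_flag_ext]]]
  by (simp_all add: unified_mult_flag_ext)

end

section \<open>Coordinates on E with respect to A and x\<close>

locale codim_one_extension = unital_algebra_over_field sA + E: vector_space sE
  for sA :: "'k::field \<Rightarrow> 'a::{ring,monoid_mult} \<Rightarrow> 'a"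
    and sE :: "'k \<Rightarrow> 'e::ab_group_add \<Rightarrow> 'e" +
  fixes \<iota> :: "'a \<Rightarrow> 'e" and V :: "'e set" and x :: 'e
  assumes linear_incl: "Vector_Spaces.linear sA sE \<iota>" and inj_incl: "inj \<iota>"
    and complement: "range \<iota> \<inter> V = {0}" "{\<iota> a + v |a v. v \<in> V} = UNIV"
    and basis: "\<not> E.dependent {x}" "E.span {x} = V"
begin

lemma x_nonzero: "x \<noteq> 0"
  using basis(1) by simp

lemma V_eq: "V = range (\<lambda>s. sE s x)"
  using basis(2) E.span_singleton by simp

text \<open>A multiple of x that lies in A lies in the intersection with V, which is zero. This
  makes coordinates on E unique.\<close>

lemma range_incl_line: "\<iota> a = sE s x \<Longrightarrow> a = 0 \<and> s = 0"
proof -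
  assume eq: "\<iota> a = sE s x"
  then have "\<iota> a \<in> range \<iota> \<inter> V"
    unfolding V_eq by blast
  then have "\<iota> a = 0"
    using complement(1) by simp
  with eq show ?thesis
    using x_nonzero inj_incl linear_simps(3)[OF linear_incl] by (metis E.scale_eq_0_iff injD)
qed

abbreviation \<psi> :: "'a \<times> 'k \<Rightarrow> 'e" where
  "\<psi> \<equiv> to_E sE \<iota> x"

lemma bij_to_E: "bij \<psi>"
proof (rule bijI)
  show "inj \<psi>"
  proof (rule injI)
    fix p p' :: "'a \<times> 'k" assume *: "\<psi> p = \<psi> p'"
    obtain a s b t where p: "p = (a, s)" "p' = (b, t)"
      by (cases p, cases p')
    from * have "\<iota> (a - b) = sE (t - s) x"
      by (simp add: p to_E_def linear_simps[OF linear_incl] algebra_simps)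
    then show "p = p'"
      using range_incl_line[of "a - b" "t - s"] by (simp add: p)
  qed
  show "surj \<psi>"
  proof -
    have "\<exists>p. e = \<psi> p" for e
    proof -
      from complement(2) obtain a v where "e = \<iota> a + v" "v \<in> V"
        by blast
      then obtain s where "e = \<psi> (a, s)"
        by (auto simp: V_eq to_E_def)
      then show ?thesis ..
    qed
    then show ?thesis
      unfolding surj_def by blast
  qed
qed

lemma inv_to_E [simp]: "inv \<psi> (\<psi> p) = p" "\<psi> (inv \<psi> e) = e"
  by (simp_all add: bij_to_E bij_is_inj bij_is_surj surj_f_inv_f)

lemma linear_to_E: "Vector_Spaces.linear (scale_prod sA) sE \<psi>"
  by (auto simp: Vector_Spaces.linear_iff vector_space_scale_prod E.vector_space_axioms to_E_def
      scale_prod_def linear_simps[OF linear_incl] algebra_simps)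

lemma to_E_incl [simp]: "\<psi> (a, 0) = \<iota> a"
  by (simp add: to_E_def)

lemma inv_to_E_incl [simp]: "inv \<psi> (\<iota> a) = (a, 0)"
  by (metis inv_to_E(1) to_E_incl)

text \<open>\<open>proj_along\<close> is a definite description, so the component in V has to be
  shown unique; this is again the independence of A and x.\<close>

lemma proj_along_to_E: "proj_along (range \<iota>) V (\<psi> (a, s)) = sE s x"
  unfolding proj_along_def
proof (rule the_equality)
  show "sE s x \<in> V \<and> \<psi> (a, s) - sE s x \<in> range \<iota>"
    by (auto simp: V_eq to_E_def)
next
  fix v assume v: "v \<in> V \<and> \<psi> (a, s) - v \<in> range \<iota>"
  then obtain t b where vt: "v = sE t x" and "\<psi> (a, s) - v = \<iota> b"
    by (auto simp: V_eq)
  then have "\<iota> (b - a) = sE (s - t) x"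
    by (simp add: to_E_def linear_simps[OF linear_incl] algebra_simps)
  then show "v = sE s x"
    using range_incl_line[of "b - a" "s - t"] by (simp add: vt)
qed

text \<open>Since \<psi> sends (a, 0) to \<iota> a, having A as a subalgebra means that the product
  on A x k has unit (1, 0) and restricts to the product of A.\<close>

lemma transport_alg_structs_iff:
  "transport \<psi> m \<in> alg_structs sA sE \<iota> \<longleftrightarrow>
    bilinear_map (scale_prod sA) (scale_prod sA) (scale_prod sA) m \<and> assoc_with_unit m (1, 0) \<and>
    (\<forall>a b. m (a, 0) (b, 0) = (a * b, 0))"
proof -
  have "bilinear_map sE sE sE (transport \<psi> m) \<longleftrightarrow>
      bilinear_map (scale_prod sA) (scale_prod sA) (scale_prod sA) m"
    using bilinear_map_transport[OF linear_to_E bij_to_E, of m]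
      bilinear_map_transport[OF linear_inv[OF linear_to_E bij_to_E] bij_imp_bij_inv[OF bij_to_E],
        of "transport \<psi> m"]
      transport_inv[OF bij_imp_bij_inv[OF bij_to_E], of m] by (auto simp: inv_inv_eq[OF bij_to_E])
  moreover have "(\<iota> (a * b) = transport \<psi> m (\<iota> a) (\<iota> b)) \<longleftrightarrow> m (a, 0) (b, 0) = (a * b, 0)" for a b
  proof -
    have "transport \<psi> m (\<iota> a) (\<iota> b) = \<psi> (m (a, 0) (b, 0))"
      by (simp add: transport_def)
    then show ?thesis
      by (metis inv_to_E(1) to_E_incl)
  qed
  ultimately show ?thesis
    using assoc_with_unit_transport[OF bij_to_E, of m "(1, 0)"]
    by (auto simp: alg_structs_def unital_algebra_def algebra_map_def E.vector_space_axioms linear_incl)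
qed

text \<open>For surjectivity a structure is pulled back to A x k and its tuple is read off there;
  associativity of the structure then becomes the flag axioms.\<close>

lemma bij_betw_flag_algebra:
  "bij_betw (flag_algebra sA sE \<iota> x) (flag_datums sA) (alg_structs sA sE \<iota>)"
proof (rule bij_betw_imageI)
  show "inj_on (flag_algebra sA sE \<iota> x) (flag_datums sA)"
    by (rule inj_onI) (simp add: flag_algebra_def transport_eq_iff[OF bij_to_E] flag_mult_inject)
  show "flag_algebra sA sE \<iota> x ` flag_datums sA = alg_structs sA sE \<iota>"
  proof (intro equalityI image_subsetI subsetI)
    fix F assume F: "F \<in> flag_datums sA"
    obtain L l D d a0 u where F_eq: "F = (L, l, D, d, a0, u)"
      by (metis prod_cases6)
    from F have lin: "Vector_Spaces.linear sA (*) L" "Vector_Spaces.linear sA (*) l"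
      "Vector_Spaces.linear sA sA D" "Vector_Spaces.linear sA sA d"
      by (auto simp: F_eq flag_datums_def algebra_map_def)
    show "flag_algebra sA sE \<iota> x F \<in> alg_structs sA sE \<iota>"
      using F flag_datums_iff_assoc_with_unit[OF lin, of a0 u] bilinear_map_flag_mult[OF lin, of a0 u]
      by (simp add: flag_algebra_def transport_alg_structs_iff F_eq)
  next
    fix m assume "m \<in> alg_structs sA sE \<iota>"
    moreover define m0 where "m0 = transport (inv \<psi>) m"
    then have m: "m = transport \<psi> m0"
      by (simp add: transport_inv[OF bij_to_E])
    ultimately have m0: "bilinear_map (scale_prod sA) (scale_prod sA) (scale_prod sA) m0"
      "assoc_with_unit m0 (1, 0)" "m0 (a, 0) (b, 0) = (a * b, 0)" for a b
      by (simp_all add: transport_alg_structs_iff)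
    obtain L l D d a0 u where F: "m0 = flag_mult sA (L, l, D, d, a0, u)"
      and lin: "Vector_Spaces.linear sA (*) L" "Vector_Spaces.linear sA (*) l"
        "Vector_Spaces.linear sA sA D" "Vector_Spaces.linear sA sA d"
      using bilinear_map_is_flag_mult[OF m0(1,3)] by blast
    have "(L, l, D, d, a0, u) \<in> flag_datums sA"
      using m0(2) flag_datums_iff_assoc_with_unit[OF lin] F by simp
    moreover have "m = flag_algebra sA sE \<iota> x (L, l, D, d, a0, u)"
      by (simp add: flag_algebra_def m F)
    ultimately show "m \<in> flag_algebra sA sE \<iota> x ` flag_datums sA"
      by blast
  qed
qed

lemma unified_algebra_flag_ext: "unified_algebra sE \<iota> x (flag_ext sA F) = flag_algebra sA sE \<iota> x F"
  by (simp add: unified_algebra_def flag_algebra_def unified_mult_flag_ext)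

text \<open>Two maps of the triangle formed with \<open>flag_ext\<close> and
  \<open>flag_algebra\<close> are known to be bijective, hence so is the third.\<close>

lemma bij_betw_unified_algebra:
  "bij_betw (unified_algebra sE \<iota> x) (AE sA (*)) (alg_structs sA sE \<iota>)"
proof -
  have "unified_algebra sE \<iota> x \<circ> flag_ext sA = flag_algebra sA sE \<iota> x"
    by (simp add: fun_eq_iff unified_algebra_flag_ext)
  then show ?thesis
    using bij_betw_comp_iff[OF bij_betw_flag_ext, of "unified_algebra sE \<iota> x"] bij_betw_flag_algebra by simp
qed

section \<open>Isomorphisms that fix A\<close>

lemma stabilizes_automorphism_iff:
  "Vector_Spaces.linear sE sE \<phi> \<and> bij \<phi> \<and> stabilizes \<iota> \<phi> \<longleftrightarrow>
    (\<exists>q \<alpha>. q \<noteq> 0 \<and> \<phi> = \<psi> \<circ> shear sA q \<alpha> \<circ> inv \<psi>)" (is "?L \<longleftrightarrow> ?R")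
proof
  assume L: ?L
  obtain \<alpha> q where x: "inv \<psi> (\<phi> x) = (\<alpha>, q)"
    by (cases "inv \<psi> (\<phi> x)")
  then have \<phi>x: "\<phi> x = \<iota> \<alpha> + sE q x"
    by (metis inv_to_E(2) to_E_def prod.case)
  have "\<phi> (\<psi> p) = \<psi> (shear sA q \<alpha> p)" for p
    using L by (cases p) (simp add: to_E_def stabilizes_def linear_simps[of sE sE \<phi>] \<phi>x
        linear_simps[OF linear_incl] algebra_simps)
  then have "\<phi> e = (\<psi> \<circ> shear sA q \<alpha> \<circ> inv \<psi>) e" for e
    by (metis comp_apply inv_to_E(2))
  then have eq: "\<phi> = \<psi> \<circ> shear sA q \<alpha> \<circ> inv \<psi>" ..
  \<comment> \<open>For q = 0 the vectors x and \<iota> \<alpha> have the same image, so injectivity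
    would put x into A.\<close>
  have "q \<noteq> 0"
  proof
    assume "q = 0"
    then have "\<phi> x = \<phi> (\<iota> \<alpha>)"
      using L \<phi>x by (simp add: stabilizes_def)
    then have "\<iota> \<alpha> = sE 1 x"
      using L by (simp add: bij_is_inj inj_eq)
    then show False
      using range_incl_line[of \<alpha> 1] by simp
  qed
  with eq show ?R by blast
next
  assume ?R
  then obtain q \<alpha> where "q \<noteq> 0" and \<phi>: "\<phi> = \<psi> \<circ> shear sA q \<alpha> \<circ> inv \<psi>"
    by blast
  have "Vector_Spaces.linear (scale_prod sA) (scale_prod sA) (shear sA q \<alpha>)"
    by (auto simp: Vector_Spaces.linear_iff vector_space_scale_prod scale_prod_def algebra_simps)
  then have "Vector_Spaces.linear sE sE \<phi>"
    unfolding \<phi> by (intro Vector_Spaces.linear_compose[of _ "scale_prod sA"] linear_to_E linear_inv bij_to_E)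
  \<comment> \<open>Solving y = \<alpha> + q x for x gives x = q^-1 y - q^-1 \<alpha>, so the
    inverse is again a shear.\<close>
  moreover have "bij (shear sA q \<alpha>)"
    by (rule bij_betw_byWitness[where f' = "shear sA (inverse q) (- sA (inverse q) \<alpha>)"])
      (auto simp: \<open>q \<noteq> 0\<close>)
  then have "bij \<phi>"
    unfolding \<phi> by (intro bij_comp bij_to_E bij_imp_bij_inv)
  moreover have "stabilizes \<iota> \<phi>"
    by (simp add: stabilizes_def \<phi>)
  ultimately show ?L by blast
qed

text \<open>The projection to V sees only the coordinate of x, which a shear multiplies by
  q.\<close>

lemma costabilizes_iff: "costabilizes \<iota> V (\<psi> \<circ> shear sA q \<alpha> \<circ> inv \<psi>) \<longleftrightarrow> q = 1"
proof -
  let ?\<pi> = "proj_along (range \<iota>) V"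
  have "costabilizes \<iota> V (\<psi> \<circ> shear sA q \<alpha> \<circ> inv \<psi>) \<longleftrightarrow> (\<forall>p. ?\<pi> (\<psi> (shear sA q \<alpha> p)) = ?\<pi> (\<psi> p))"
    unfolding costabilizes_def fun_eq_iff comp_apply by (metis inv_to_E)
  also have "\<dots> \<longleftrightarrow> (\<forall>s. sE (q * s) x = sE s x)"
    by (simp add: proj_along_to_E)
  also have "\<dots> \<longleftrightarrow> q = 1"
    using x_nonzero by (metis E.scale_cancel_right mult.right_neutral mult_1)
  finally show ?thesis .
qed

lemma extd_rel_iff_multiplicative:
  assumes "transport \<psi> m \<in> alg_structs sA sE \<iota>" "transport \<psi> m' \<in> alg_structs sA sE \<iota>"
  shows "(transport \<psi> m, transport \<psi> m') \<in> extd_rel sA sE \<iota> \<longleftrightarrow>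
      (\<exists>q \<alpha>. q \<noteq> 0 \<and> multiplicative m m' (shear sA q \<alpha>))" (is ?extd)
    and "(transport \<psi> m, transport \<psi> m') \<in> extd'_rel sA sE \<iota> V \<longleftrightarrow>
      (\<exists>\<alpha>. multiplicative m m' (shear sA 1 \<alpha>))" (is ?extd')
proof -
  \<comment> \<open>Fixing A includes fixing the unit \<iota> 1, so preservation of the unit is
    automatic here.\<close>
  have "alg_iso sE (\<iota> 1) (transport \<psi> m) (transport \<psi> m') \<phi> \<and> stabilizes \<iota> \<phi> \<longleftrightarrow>
      (Vector_Spaces.linear sE sE \<phi> \<and> bij \<phi> \<and> stabilizes \<iota> \<phi>) \<and>
      multiplicative (transport \<psi> m) (transport \<psi> m') \<phi>" for \<phi>
    by (auto simp: alg_iso_def algebra_map_def multiplicative_def stabilizes_def)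
  also have "\<dots> \<phi> \<longleftrightarrow> (\<exists>q \<alpha>. q \<noteq> 0 \<and> \<phi> = \<psi> \<circ> shear sA q \<alpha> \<circ> inv \<psi> \<and> multiplicative m m' (shear sA q \<alpha>))"
    for \<phi>
    unfolding stabilizes_automorphism_iff using multiplicative_transport[OF bij_to_E] by blast
  finally have iso: "alg_iso sE (\<iota> 1) (transport \<psi> m) (transport \<psi> m') \<phi> \<and> stabilizes \<iota> \<phi> \<longleftrightarrow>
    (\<exists>q \<alpha>. q \<noteq> 0 \<and> \<phi> = \<psi> \<circ> shear sA q \<alpha> \<circ> inv \<psi> \<and> multiplicative m m' (shear sA q \<alpha>))" for \<phi> .
  show ?extd
    using assms iso unfolding extd_rel_def by blast
  have "(transport \<psi> m, transport \<psi> m') \<in> extd'_rel sA sE \<iota> V \<longleftrightarrow>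
      (\<exists>\<phi>. (alg_iso sE (\<iota> 1) (transport \<psi> m) (transport \<psi> m') \<phi> \<and> stabilizes \<iota> \<phi>) \<and> costabilizes \<iota> V \<phi>)"
    using assms unfolding extd'_rel_def by blast
  also have "\<dots> \<longleftrightarrow> (\<exists>q \<alpha>. q \<noteq> 0 \<and> multiplicative m m' (shear sA q \<alpha>) \<and>
      costabilizes \<iota> V (\<psi> \<circ> shear sA q \<alpha> \<circ> inv \<psi>))"
    unfolding iso by blast
  also have "\<dots> \<longleftrightarrow> (\<exists>\<alpha>. multiplicative m m' (shear sA 1 \<alpha>))"
    unfolding costabilizes_iff by auto
  finally show ?extd' .
qed

section \<open>Equivalence of algebra structures on E\<close>

lemma alg_iso_id: "m \<in> alg_structs sA sE \<iota> \<Longrightarrow> alg_iso sE (\<iota> 1) m m id"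
  by (auto simp: alg_iso_def algebra_map_def alg_structs_def E.linear_id)

lemma alg_iso_comp:
  "alg_iso sE e m m' \<phi> \<Longrightarrow> alg_iso sE e m' m'' \<phi>' \<Longrightarrow> alg_iso sE e m m'' (\<phi>' \<circ> \<phi>)"
  by (auto simp: alg_iso_def algebra_map_def intro: bij_comp Vector_Spaces.linear_compose)

lemma alg_iso_inv:
  assumes "alg_iso sE e m m' \<phi>"
  shows "alg_iso sE e m' m (inv \<phi>)"
proof -
  have \<phi>: "Vector_Spaces.linear sE sE \<phi>" "bij \<phi>" "\<phi> e = e" "\<phi> (m y z) = m' (\<phi> y) (\<phi> z)" for y z
    using assms by (auto simp: alg_iso_def algebra_map_def)
  have "inv \<phi> (m' y z) = m (inv \<phi> y) (inv \<phi> z)" for y z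
    using \<phi>(2,4) by (intro inv_f_eq) (simp_all add: bij_is_inj bij_is_surj surj_f_inv_f)
  moreover have "inv \<phi> e = e"
    using \<phi>(2,3) by (intro inv_f_eq bij_is_inj)
  ultimately show ?thesis
    using linear_inv[OF \<phi>(1,2)] bij_imp_bij_inv[OF \<phi>(2)] by (simp add: alg_iso_def algebra_map_def)
qed

lemma stabilizes_inv: "bij \<phi> \<Longrightarrow> stabilizes \<iota> \<phi> \<Longrightarrow> stabilizes \<iota> (inv \<phi>)"
  by (auto simp: stabilizes_def intro: inv_f_eq bij_is_inj)

text \<open>Composing \<pi> \<circ> \<phi> = \<pi> on the right with the inverse of \<phi> gives the
  claim.\<close>

lemma costabilizes_inv:
  assumes "bij \<phi>" "costabilizes \<iota> V \<phi>"
  shows "costabilizes \<iota> V (inv \<phi>)"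
  using assms unfolding costabilizes_def
  by (metis bij_is_surj comp_assoc comp_id surj_iff)

lemma equiv_extd_rel: "equiv (alg_structs sA sE \<iota>) (extd_rel sA sE \<iota>)"
proof (rule equivI)
  show "refl_on (alg_structs sA sE \<iota>) (extd_rel sA sE \<iota>)"
    using alg_iso_id by (fastforce simp: refl_on_def extd_rel_def stabilizes_def)
  show "sym (extd_rel sA sE \<iota>)"
    unfolding sym_def extd_rel_def using alg_iso_inv stabilizes_inv alg_iso_def by blast
  have "stabilizes \<iota> (\<phi>' \<circ> \<phi>)" if "stabilizes \<iota> \<phi>" "stabilizes \<iota> \<phi>'" for \<phi> \<phi>'
    using that by (simp add: stabilizes_def)
  then show "trans (extd_rel sA sE \<iota>)"
    unfolding trans_def extd_rel_def using alg_iso_comp by blast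
qed (auto simp: extd_rel_def)

lemma equiv_extd'_rel: "equiv (alg_structs sA sE \<iota>) (extd'_rel sA sE \<iota> V)"
proof (rule equivI)
  show "refl_on (alg_structs sA sE \<iota>) (extd'_rel sA sE \<iota> V)"
    using alg_iso_id by (fastforce simp: refl_on_def extd'_rel_def stabilizes_def costabilizes_def)
  show "sym (extd'_rel sA sE \<iota> V)"
    unfolding sym_def extd'_rel_def using alg_iso_inv stabilizes_inv costabilizes_inv alg_iso_def by blast
  have "stabilizes \<iota> (\<phi>' \<circ> \<phi>)" if "stabilizes \<iota> \<phi>" "stabilizes \<iota> \<phi>'" for \<phi> \<phi>'
    using that by (simp add: stabilizes_def)
  moreover have "costabilizes \<iota> V (\<phi>' \<circ> \<phi>)" if "costabilizes \<iota> V \<phi>" "costabilizes \<iota> V \<phi>'" for \<phi> \<phi>'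
    using that unfolding costabilizes_def by (metis comp_assoc)
  ultimately show "trans (extd'_rel sA sE \<iota> V)"
    unfolding trans_def extd'_rel_def using alg_iso_comp by blast
qed (auto simp: extd'_rel_def)

text \<open>Both sides assert the existence of the same multiplicative shear between the two unified
  products.\<close>

lemma unified_algebra_related_iff:
  assumes "S \<in> AE sA (*)" "S' \<in> AE sA (*)"
  shows "(S, S') \<in> AH2A_rel sA (*) \<longleftrightarrow>
      (unified_algebra sE \<iota> x S, unified_algebra sE \<iota> x S') \<in> extd_rel sA sE \<iota>"
    and "(S, S') \<in> AH2_rel sA (*) \<longleftrightarrow>
      (unified_algebra sE \<iota> x S, unified_algebra sE \<iota> x S') \<in> extd'_rel sA sE \<iota> V"
proof -
  have "transport \<psi> (unified_mult S) \<in> alg_structs sA sE \<iota>" if "S \<in> AE sA (*)" for S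
    using that bij_betw_apply[OF bij_betw_unified_algebra] by (simp add: unified_algebra_def)
  note * = extd_rel_iff_multiplicative[OF this[OF assms(1)] this[OF assms(2)]]
  show "(S, S') \<in> AH2A_rel sA (*) \<longleftrightarrow>
      (unified_algebra sE \<iota> x S, unified_algebra sE \<iota> x S') \<in> extd_rel sA sE \<iota>"
    and "(S, S') \<in> AH2_rel sA (*) \<longleftrightarrow>
      (unified_algebra sE \<iota> x S, unified_algebra sE \<iota> x S') \<in> extd'_rel sA sE \<iota> V"
    unfolding unified_algebra_def * AH2A_rel_iff_multiplicative[OF assms] by (rule refl)+
qed

end

theorem theorem3p4:
  fixes sA :: "'k::field \<Rightarrow> 'a::{ring,monoid_mult} \<Rightarrow> 'a"
    and sE :: "'k \<Rightarrow> 'e::ab_group_add \<Rightarrow> 'e"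
    and \<iota> :: "'a \<Rightarrow> 'e" and V :: "'e set" and x :: 'e
  assumes A: "unital_algebra sA (*) 1"
    and E: "vector_space sE"
    and incl: "Vector_Spaces.linear sA sE \<iota>" "inj \<iota>"
    and V: "module.subspace sE V" "range \<iota> \<inter> V = {0}" "{\<iota> a + v |a v. v \<in> V} = UNIV"
    and x: "\<not> module.dependent sE {x}" "module.span sE {x} = V"
  shows
    "(equiv (flag_datums sA) (flag_equiv sA) \<and>
      (\<exists>\<Psi> \<Theta>.
         bij_betw \<Psi> (AH2A sA ((*) :: 'k \<Rightarrow> 'k \<Rightarrow> 'k)) (Extd sA sE \<iota>) \<and>
         (\<forall>S \<in> AE sA ((*) :: 'k \<Rightarrow> 'k \<Rightarrow> 'k).
            \<Psi> (AH2A_rel sA (*) `` {S}) = extd_rel sA sE \<iota> `` {unified_algebra sE \<iota> x S}) \<and>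
         bij_betw \<Theta> (flag_datums sA // flag_equiv sA) (AH2A sA ((*) :: 'k \<Rightarrow> 'k \<Rightarrow> 'k)) \<and>
         bij_betw (\<Psi> \<circ> \<Theta>) (flag_datums sA // flag_equiv sA) (Extd sA sE \<iota>) \<and>
         (\<forall>F \<in> flag_datums sA.
            (\<Psi> \<circ> \<Theta>) (flag_equiv sA `` {F}) = extd_rel sA sE \<iota> `` {flag_algebra sA sE \<iota> x F})))
     \<and>
     (equiv (flag_datums sA) (flag_approx sA) \<and>
      (\<exists>\<Psi> \<Theta>.
         bij_betw \<Psi> (AH2 sA ((*) :: 'k \<Rightarrow> 'k \<Rightarrow> 'k)) (Extd' sA sE \<iota> V) \<and>
         (\<forall>S \<in> AE sA ((*) :: 'k \<Rightarrow> 'k \<Rightarrow> 'k).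
            \<Psi> (AH2_rel sA (*) `` {S}) = extd'_rel sA sE \<iota> V `` {unified_algebra sE \<iota> x S}) \<and>
         bij_betw \<Theta> (flag_datums sA // flag_approx sA) (AH2 sA ((*) :: 'k \<Rightarrow> 'k \<Rightarrow> 'k)) \<and>
         bij_betw (\<Psi> \<circ> \<Theta>) (flag_datums sA // flag_approx sA) (Extd' sA sE \<iota> V) \<and>
         (\<forall>F \<in> flag_datums sA.
            (\<Psi> \<circ> \<Theta>) (flag_approx sA `` {F}) = extd'_rel sA sE \<iota> V `` {flag_algebra sA sE \<iota> x F})))"
proof -
  interpret codim_one_extension sA sE \<iota> V x
    using assms by (intro codim_one_extension.intro unital_algebra_over_field.intro
        codim_one_extension_axioms.intro)
  have sub: "flag_equiv sA \<subseteq> flag_datums sA \<times> flag_datums sA"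
    "flag_approx sA \<subseteq> flag_datums sA \<times> flag_datums sA"
    "AH2A_rel sA (*) \<subseteq> AE sA (*) \<times> AE sA ((*) :: 'k \<Rightarrow> 'k \<Rightarrow> 'k)"
    "AH2_rel sA (*) \<subseteq> AE sA (*) \<times> AE sA ((*) :: 'k \<Rightarrow> 'k \<Rightarrow> 'k)"
    by (auto simp: flag_equiv_def flag_approx_def AH2A_rel_def AH2_rel_def)
  note bij = bij_betw_flag_ext bij_betw_unified_algebra
  \<comment> \<open>Writing \<open>flag_algebra\<close> as \<open>unified_algebra\<close> after
    \<open>flag_ext\<close> gives the clause on flag datums the shape \<open>h (g a)\<close>, so
    that both halves become instances of \<open>quotient_bij_comp\<close> with the same two
    bijections.\<close>
  show ?thesis
    unfolding Extd_def Extd'_def AH2A_def AH2_def unified_algebra_flag_ext[symmetric]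
    by (intro conjI[OF quotient_bij_comp[OF bij equiv_extd_rel sub(1,3)]
          quotient_bij_comp[OF bij equiv_extd'_rel sub(2,4)]]
        flag_ext_related_iff unified_algebra_related_iff)
qed

end
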